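(* $\mathfrak{b}\le\mathfrak{S}'$.
   Context: A partition of $\omega$ is a set of pairwise disjoint nonempty subsets of $\omega$ (blocks) with union $\omega$. $(\omega)^\omega$ is the set of partitions with infinitely many blocks, $(\omega)^\omega_\infty$ the set of those $X\in(\omega)^\omega$ with at least one infinite block. $X\sqsubseteq Y$ ($X$ coarser than $Y$) means every block of $X$ is a union of blocks of $Y$; $X\sqcup Y$ is the finest partition coarser than both $X$ and $Y$. For finite $f\subseteq\omega$, $X\sqcup\{f\}$ is the finest partition coarser than $X$ having $f$ inside one block; $X\sqsubseteq^*Y$ iff $X\sqcup\{f\}\sqsubseteq Y$ for some finite $f$; $X\approx Y$ iff $X\sqsubseteq^*Y$ and $Y\sqsubseteq^*X$. $X$ is trivial if $X\approx$ the partition of $\omega$ into singletons. $X_1,X_2\in(\omega)^\omega$ are compatible if $X_1\sqcup X_2\in(\omega)^\omega$, and orthogonal ($X_1\perp X_2$) if $X_1\sqcup X_2$ has exactly one block $\omega$. $X_1$ splits $X_2$ if $X_1$ is compatible with $X_2$ and there is $Y\in(\omega)^\omega$ with $Y\sqsubseteq X_2$ and $X_1\perp Y$. A family $\mathcal{S}$ is splitting if every non-trivial $X\in(\omega)^\omega$ is split by some $S\in\mathcal{S}$. $\mathfrak{S}'$ is the least cardinality of a splitting family $\mathcal{S}\subseteq(\omega)^\omega_\infty$. $\mathfrak{b}$ is the bounding number. *)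

theory Defs
  imports "HOL-Library.Disjoint_Sets"
begin

unbundle cardinal_syntax

section \<open>Least cardinalities\<close>

text \<open>
  The least cardinality of a member of a class of sets, as a cardinal order. The choice makes it
  unique up to \<open>=o\<close> for a nonempty class; for the empty class it is unspecified.
\<close>

definition least_card :: "'a set set \<Rightarrow> 'a rel" where
  "least_card \<A> = (SOME r. (\<exists>A\<in>\<A>. r = |A| ) \<and> (\<forall>A\<in>\<A>. r \<le>o |A| ))"

lemma least_card:
  assumes "\<A> \<noteq> {}"
  shows "\<exists>A\<in>\<A>. least_card \<A> = |A|" and "\<And>A. A \<in> \<A> \<Longrightarrow> least_card \<A> \<le>o |A|"
proof -
  have "\<exists>r\<in>card_of ` \<A>. \<forall>r'\<in>card_of ` \<A>. r \<le>o r'"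
    using assms by (intro exists_minim_Card_order) (auto intro: card_of_Card_order)
  then have "\<exists>r. (\<exists>A\<in>\<A>. r = |A| ) \<and> (\<forall>A\<in>\<A>. r \<le>o |A| )"
    by blast
  from someI_ex[OF this]
  have *: "(\<exists>A\<in>\<A>. least_card \<A> = |A| ) \<and> (\<forall>A\<in>\<A>. least_card \<A> \<le>o |A| )"
    unfolding least_card_def .
  show "\<exists>A\<in>\<A>. least_card \<A> = |A|"
    using * by blast
  show "least_card \<A> \<le>o |A|" if "A \<in> \<A>" for A
    using * that by blast
qed

section \<open>The bounding number\<close>

definition eventually_dominated :: "(nat \<Rightarrow> nat) \<Rightarrow> (nat \<Rightarrow> nat) \<Rightarrow> bool" where
  "eventually_dominated f g \<longleftrightarrow> (\<forall>\<^sub>F n in sequentially. f n \<le> g n)"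

definition unbounded_family :: "(nat \<Rightarrow> nat) set \<Rightarrow> bool" where
  "unbounded_family B \<longleftrightarrow> \<not> (\<exists>g. \<forall>f\<in>B. eventually_dominated f g)"

definition bounding_number :: "(nat \<Rightarrow> nat) rel" where
  "bounding_number = least_card {B. unbounded_family B}"

section \<open>Partitions of the natural numbers\<close>

type_synonym partition = "nat set set"

definition inf_partitions :: "partition set" where
  "inf_partitions = {X. partition_on UNIV X \<and> infinite X}"

definition inf_partitions_inf_block :: "partition set" where
  "inf_partitions_inf_block = {X \<in> inf_partitions. \<exists>b\<in>X. infinite b}"

definition coarser :: "partition \<Rightarrow> partition \<Rightarrow> bool" (infix "\<sqsubseteq>" 50) where
  "X \<sqsubseteq> Y \<longleftrightarrow> (\<forall>b\<in>X. \<exists>C\<subseteq>Y. b = \<Union>C)"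

definition finest :: "partition set \<Rightarrow> partition" where
  "finest \<Z> = (THE Z. Z \<in> \<Z> \<and> (\<forall>W\<in>\<Z>. W \<sqsubseteq> Z))"

definition common_coarsening :: "partition \<Rightarrow> partition \<Rightarrow> partition" (infixl "\<squnion>" 65) where
  "X \<squnion> Y = finest {Z. partition_on UNIV Z \<and> Z \<sqsubseteq> X \<and> Z \<sqsubseteq> Y}"

text \<open>\<open>merge X f\<close> is the partition usually written \<open>X \<squnion> {f}\<close>.\<close>

definition merge :: "partition \<Rightarrow> nat set \<Rightarrow> partition" where
  "merge X f = finest {Z. partition_on UNIV Z \<and> Z \<sqsubseteq> X \<and> (\<exists>b\<in>Z. f \<subseteq> b)}"

definition almost_coarser :: "partition \<Rightarrow> partition \<Rightarrow> bool" (infix "\<sqsubseteq>*" 50) where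
  "X \<sqsubseteq>* Y \<longleftrightarrow> (\<exists>f. finite f \<and> merge X f \<sqsubseteq> Y)"

definition almost_equal :: "partition \<Rightarrow> partition \<Rightarrow> bool" (infix "\<approx>" 50) where
  "X \<approx> Y \<longleftrightarrow> X \<sqsubseteq>* Y \<and> Y \<sqsubseteq>* X"

definition trivial_partition :: "partition \<Rightarrow> bool" where
  "trivial_partition X \<longleftrightarrow> X \<approx> range (\<lambda>n. {n})"

definition compatible :: "partition \<Rightarrow> partition \<Rightarrow> bool" where
  "compatible X Y \<longleftrightarrow> X \<squnion> Y \<in> inf_partitions"

definition orthogonal :: "partition \<Rightarrow> partition \<Rightarrow> bool" (infix "\<bottom>" 50) where
  "X \<bottom> Y \<longleftrightarrow> X \<squnion> Y = {UNIV}"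

definition splits :: "partition \<Rightarrow> partition \<Rightarrow> bool" where
  "splits S X \<longleftrightarrow> compatible S X \<and> (\<exists>Y\<in>inf_partitions. Y \<sqsubseteq> X \<and> S \<bottom> Y)"

definition splitting_family :: "partition set \<Rightarrow> bool" where
  "splitting_family \<S> \<longleftrightarrow>
     \<S> \<subseteq> inf_partitions \<and>
     (\<forall>X\<in>inf_partitions. \<not> trivial_partition X \<longrightarrow> (\<exists>S\<in>\<S>. splits S X))"

definition splitting_number' :: "partition rel" where
  "splitting_number' = least_card {\<S>. splitting_family \<S> \<and> \<S> \<subseteq> inf_partitions_inf_block}"

section \<open>The finest partitions used above exist and are unique\<close>

lemma coarser_iff:
  assumes "partition_on UNIV X" "partition_on UNIV Y"
  shows "X \<sqsubseteq> Y \<longleftrightarrow> (\<forall>c\<in>Y. \<exists>b\<in>X. c \<subseteq> b)"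
proof
  assume XY: "X \<sqsubseteq> Y"
  show "\<forall>c\<in>Y. \<exists>b\<in>X. c \<subseteq> b"
  proof
    fix c assume c: "c \<in> Y"
    then obtain n where n: "n \<in> c"
      using partition_onD3[OF assms(2)] by (metis ex_in_conv)
    obtain b where b: "b \<in> X" "n \<in> b"
      using partition_onD1[OF assms(1)] by blast
    then obtain C where C: "C \<subseteq> Y" "b = \<Union>C"
      using XY unfolding coarser_def by blast
    then obtain d where d: "d \<in> C" "n \<in> d"
      using b by blast
    then have "d = c"
      using C c n partition_onD2[OF assms(2)] unfolding disjoint_def by blast
    then show "\<exists>b\<in>X. c \<subseteq> b"
      using b C d by blast
  qed
next
  assume R: "\<forall>c\<in>Y. \<exists>b\<in>X. c \<subseteq> b"
  show "X \<sqsubseteq> Y"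
    unfolding coarser_def
  proof
    fix b assume b: "b \<in> X"
    have "b \<subseteq> \<Union>{c\<in>Y. c \<subseteq> b}"
    proof
      fix n assume n: "n \<in> b"
      obtain c where c: "c \<in> Y" "n \<in> c"
        using partition_onD1[OF assms(2)] by blast
      obtain b' where b': "b' \<in> X" "c \<subseteq> b'"
        using R c by blast
      then have "b' = b"
        using b n c partition_onD2[OF assms(1)] unfolding disjoint_def by blast
      then show "n \<in> \<Union>{c\<in>Y. c \<subseteq> b}"
        using c b' by blast
    qed
    then show "\<exists>C\<subseteq>Y. b = \<Union>C"
      by (intro exI[of _ "{c\<in>Y. c \<subseteq> b}"]) auto
  qed
qed

lemma coarser_antisym:
  assumes "partition_on UNIV X" "partition_on UNIV Y" "X \<sqsubseteq> Y" "Y \<sqsubseteq> X"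
  shows "X = Y"
proof -
  have "refines UNIV X Y" "refines UNIV Y X"
    using assms coarser_iff unfolding refines_def by auto
  then show ?thesis
    by (rule refines_asym)
qed

lemma ex_finest_with_blocks_above:
  fixes F :: "nat set set"
  defines "\<Z> \<equiv> {Z. partition_on UNIV Z \<and> (\<forall>c\<in>F. \<exists>b\<in>Z. c \<subseteq> b)}"
  shows "\<exists>Z\<in>\<Z>. \<forall>W\<in>\<Z>. W \<sqsubseteq> Z"
proof -
  define r where "r = (\<Union>c\<in>F. c \<times> c)\<^sup>*"
  have "sym (\<Union>c\<in>F. c \<times> c)"
    by (auto simp: sym_def)
  then have eq: "equiv UNIV r"
    unfolding r_def equiv_def by (auto intro: refl_rtrancl sym_rtrancl trans_rtrancl)
  have part: "partition_on UNIV (UNIV // r)"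
    using eq by (rule partition_on_quotient)
  have above: "\<exists>b\<in>UNIV // r. c \<subseteq> b" if "c \<in> F" for c
  proof (cases "c = {}")
    case True
    then show ?thesis by (auto simp: quotient_def)
  next
    case False
    then obtain n where "n \<in> c" by blast
    then have "c \<subseteq> r `` {n}"
      using that unfolding r_def by blast
    then show ?thesis by (auto simp: quotient_def)
  qed
  have fin: "W \<sqsubseteq> UNIV // r" if "W \<in> \<Z>" for W
  proof -
    have W: "partition_on UNIV W" "\<And>c. c \<in> F \<Longrightarrow> \<exists>b\<in>W. c \<subseteq> b"
      using that unfolding \<Z>_def by auto
    have step: "m \<in> b" if "(n, m) \<in> r" "b \<in> W" "n \<in> b" for n m b
      using that unfolding r_def
    proof (induction rule: rtrancl_induct)
      case (step k l)
      then obtain c where c: "c \<in> F" "k \<in> c" "l \<in> c" by blast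
      obtain b' where b': "b' \<in> W" "c \<subseteq> b'"
        using W(2) c by blast
      have "b' = b"
        using b' c step partition_onD2[OF W(1)] unfolding disjoint_def by blast
      then show ?case using b' c by blast
    qed
    have "\<exists>b\<in>W. r `` {n} \<subseteq> b" for n
    proof -
      obtain b where "b \<in> W" "n \<in> b"
        using partition_onD1[OF W(1)] by blast
      then show ?thesis using step by blast
    qed
    then show ?thesis
      unfolding coarser_iff[OF W(1) part] by (auto simp: quotient_def)
  qed
  show ?thesis
    using part above fin unfolding \<Z>_def by blast
qed

lemma finest:
  assumes "\<And>Z. Z \<in> \<Z> \<Longrightarrow> partition_on UNIV Z" "\<exists>Z\<in>\<Z>. \<forall>W\<in>\<Z>. W \<sqsubseteq> Z"
  shows "finest \<Z> \<in> \<Z>" and "\<And>W. W \<in> \<Z> \<Longrightarrow> W \<sqsubseteq> finest \<Z>"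
proof -
  have "\<exists>!Z. Z \<in> \<Z> \<and> (\<forall>W\<in>\<Z>. W \<sqsubseteq> Z)"
    using assms coarser_antisym by blast
  from theI'[OF this]
  show "finest \<Z> \<in> \<Z>" and "\<And>W. W \<in> \<Z> \<Longrightarrow> W \<sqsubseteq> finest \<Z>"
    unfolding finest_def by blast+
qed

lemma common_coarsening:
  assumes "partition_on UNIV X" "partition_on UNIV Y"
  shows "partition_on UNIV (X \<squnion> Y)" "X \<squnion> Y \<sqsubseteq> X" "X \<squnion> Y \<sqsubseteq> Y"
    and "\<And>W. \<lbrakk>partition_on UNIV W; W \<sqsubseteq> X; W \<sqsubseteq> Y\<rbrakk> \<Longrightarrow> W \<sqsubseteq> X \<squnion> Y"
proof -
  let ?\<Z> = "{Z. partition_on UNIV Z \<and> Z \<sqsubseteq> X \<and> Z \<sqsubseteq> Y}"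
  have "?\<Z> = {Z. partition_on UNIV Z \<and> (\<forall>c\<in>X \<union> Y. \<exists>b\<in>Z. c \<subseteq> b)}"
    using assms by (auto simp: coarser_iff)
  then have "\<exists>Z\<in>?\<Z>. \<forall>W\<in>?\<Z>. W \<sqsubseteq> Z"
    using ex_finest_with_blocks_above[of "X \<union> Y"] by simp
  note * = finest[of ?\<Z>, OF _ this, folded common_coarsening_def]
  show "partition_on UNIV (X \<squnion> Y)" "X \<squnion> Y \<sqsubseteq> X" "X \<squnion> Y \<sqsubseteq> Y"
    using *(1) by auto
  show "\<And>W. \<lbrakk>partition_on UNIV W; W \<sqsubseteq> X; W \<sqsubseteq> Y\<rbrakk> \<Longrightarrow> W \<sqsubseteq> X \<squnion> Y"
    using *(2) by auto
qed

lemma merge: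
  assumes "partition_on UNIV X"
  shows "partition_on UNIV (merge X f)" "merge X f \<sqsubseteq> X" "\<exists>b\<in>merge X f. f \<subseteq> b"
    and "\<And>W. \<lbrakk>partition_on UNIV W; W \<sqsubseteq> X; \<exists>b\<in>W. f \<subseteq> b\<rbrakk> \<Longrightarrow> W \<sqsubseteq> merge X f"
proof -
  let ?\<Z> = "{Z. partition_on UNIV Z \<and> Z \<sqsubseteq> X \<and> (\<exists>b\<in>Z. f \<subseteq> b)}"
  have "?\<Z> = {Z. partition_on UNIV Z \<and> (\<forall>c\<in>insert f X. \<exists>b\<in>Z. c \<subseteq> b)}"
    using assms by (auto simp: coarser_iff)
  then have "\<exists>Z\<in>?\<Z>. \<forall>W\<in>?\<Z>. W \<sqsubseteq> Z"
    using ex_finest_with_blocks_above[of "insert f X"] by simp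
  note * = finest[of ?\<Z>, OF _ this, folded merge_def]
  show "partition_on UNIV (merge X f)" "merge X f \<sqsubseteq> X" "\<exists>b\<in>merge X f. f \<subseteq> b"
    using *(1) by auto
  show "\<And>W. \<lbrakk>partition_on UNIV W; W \<sqsubseteq> X; \<exists>b\<in>W. f \<subseteq> b\<rbrakk> \<Longrightarrow> W \<sqsubseteq> merge X f"
    using *(2) by auto
qed

end

(* Send a partition S with an infinite block a to the function n |-> least element of a above n.
   If g bounds all these functions eventually, then cutting the natural numbers into consecutive
   intervals, each reaching from its left end x beyond g x, gives a non-trivial partition X all but
   finitely many of whose blocks meet a. Hence S \<squnion> X is finite for every S in the family, so the
   family is not splitting. *)
theory Submission
  imports Defs "HOL-Library.Infinite_Set"
begin

section \<open>Interval partitions, the coarsening order, and triviality\<close>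

lemma partition_on_intervals:
  fixes x :: "nat \<Rightarrow> nat"
  assumes "strict_mono x" "x 0 = 0"
  shows "partition_on UNIV (range (\<lambda>k. {x k..<x (Suc k)}))"
proof (rule partition_onI)
  show "\<Union>(range (\<lambda>k. {x k..<x (Suc k)})) = UNIV"
  proof (intro equalityI subsetI UNIV_I)
    fix n :: nat
    have "n < x (Suc n)"
      using strict_mono_imp_increasing[OF assms(1), of "Suc n"] by simp
    \<comment> \<open>The least such \<open>k\<close> indexes the interval of \<open>n\<close>:
      minimality gives \<open>x k \<le> n\<close> for positive \<open>k\<close>, and
      \<open>x 0 = 0\<close> gives it for \<open>k = 0\<close>.\<close>
    then obtain k where k: "n < x (Suc k)" "\<forall>j<k. \<not> n < x (Suc j)"
      using exists_least_iff[of "\<lambda>k. n < x (Suc k)"] by blast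
    have "x k \<le> n"
    proof (cases k)
      case 0
      then show ?thesis using assms(2) by simp
    next
      case (Suc j)
      then show ?thesis using k(2) by (simp add: not_less)
    qed
    with k(1) show "n \<in> \<Union>(range (\<lambda>k. {x k..<x (Suc k)}))" by auto
  qed
next
  have disj: "{x j..<x (Suc j)} \<inter> {x k..<x (Suc k)} = {}" if "j < k" for j k
    using strict_mono_mono[OF assms(1), THEN monoD, of "Suc j" k] that by auto
  fix p q assume pq: "p \<in> range (\<lambda>k. {x k..<x (Suc k)})" "q \<in> range (\<lambda>k. {x k..<x (Suc k)})"
    "p \<noteq> q"
  then obtain j k where "p = {x j..<x (Suc j)}" "q = {x k..<x (Suc k)}"
    by blast
  moreover from this pq(3) have "j < k \<or> k < j"
    by (cases j k rule: linorder_cases) simp_all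
  ultimately show "disjnt p q"
    unfolding disjnt_def using disj[of j k] disj[of k j] by (auto simp: Int_commute)
next
  show "{} \<notin> range (\<lambda>k. {x k..<x (Suc k)})"
    using strict_monoD[OF assms(1) lessI] by (simp add: image_iff not_le)
qed

lemma coarser_trans:
  assumes "X \<sqsubseteq> Y" "Y \<sqsubseteq> Z"
  shows "X \<sqsubseteq> Z"
  unfolding coarser_def
proof
  fix b assume "b \<in> X"
  then obtain C where C: "C \<subseteq> Y" "b = \<Union>C"
    using assms(1) unfolding coarser_def by blast
  have "b \<subseteq> \<Union>{d \<in> Z. d \<subseteq> b}"
  proof
    fix n assume "n \<in> b"
    then obtain c where c: "c \<in> C" "n \<in> c"
      using C(2) by blast
    then have "c \<in> Y" using C(1) by blast
    with assms(2) have "\<exists>D\<subseteq>Z. c = \<Union>D"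
      unfolding coarser_def by (rule bspec)
    then obtain D where D: "D \<subseteq> Z" "c = \<Union>D"
      by (elim exE conjE)
    then obtain d where "d \<in> D" "n \<in> d"
      using c(2) by blast
    moreover have "d \<subseteq> b" if "d \<in> D" for d
      unfolding C(2) using that D(2) c(1) by blast
    ultimately show "n \<in> \<Union>{d \<in> Z. d \<subseteq> b}"
      using D(1) by blast
  qed
  then have "b = \<Union>{d \<in> Z. d \<subseteq> b}" by blast
  then show "\<exists>C\<subseteq>Z. b = \<Union>C" by (intro exI[of _ "{d \<in> Z. d \<subseteq> b}"]) simp
qed

lemma coarser_refl: "X \<sqsubseteq> X"
  unfolding coarser_def
proof
  fix b assume "b \<in> X"
  then show "\<exists>C\<subseteq>X. b = \<Union>C" by (intro exI[of _ "{b}"]) simp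
qed

text \<open>Merging a finite set into the partition into singletons changes only finitely many
  points, and every block of \<open>X\<close> lies inside a block of the result. This is the
  criterion used to refute triviality.\<close>

lemma trivial_partition_eventually_singletons:
  assumes X: "partition_on UNIV X" and triv: "trivial_partition X"
  shows "\<exists>N. \<forall>c\<in>X. (\<forall>m\<in>c. m > N) \<longrightarrow> (\<exists>n. c = {n})"
proof -
  let ?T = "range (\<lambda>n::nat. {n})"
  have T: "partition_on UNIV ?T"
    by (auto intro!: partition_onI simp: disjnt_def)
  obtain f where f: "finite f" "merge ?T f \<sqsubseteq> X"
    using triv unfolding trivial_partition_def almost_equal_def almost_coarser_def by blast
  \<comment> \<open>Adding \<open>0\<close> keeps \<open>g\<close> nonempty, hence a legitimate
    block, even when \<open>f\<close> is empty. \<open>W\<close> is then an explicit competitor for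
    \<open>merge ?T f\<close>, which is finer by its universal property.\<close>
  define g where "g = insert 0 f"
  define W where "W = insert g ((\<lambda>n. {n}) ` (- g))"
  have W: "partition_on UNIV W"
    unfolding W_def g_def by (auto intro!: partition_onI simp: disjnt_def)
  have "W \<sqsubseteq> ?T"
    unfolding coarser_iff[OF W T] by (auto simp: W_def)
  moreover have "\<exists>b\<in>W. f \<subseteq> b"
    by (auto simp: W_def g_def)
  ultimately have "W \<sqsubseteq> X"
    using merge(4)[OF T W] f(2) coarser_trans by blast
  then have sub: "\<exists>b\<in>W. c \<subseteq> b" if "c \<in> X" for c
    using that coarser_iff[OF W X] by blast
  have "finite g" using f(1) by (simp add: g_def)
  then obtain N where N: "\<forall>m\<in>g. m \<le> N"
    by (auto simp: finite_nat_set_iff_bounded_le)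
  have "\<forall>c\<in>X. (\<forall>m\<in>c. m > N) \<longrightarrow> (\<exists>n. c = {n})"
  proof (intro ballI impI)
    fix c assume c: "c \<in> X" "\<forall>m\<in>c. m > N"
    obtain b where b: "b \<in> W" "c \<subseteq> b"
      using sub c(1) by blast
    moreover have "c \<noteq> {}"
      using partition_onD3[OF X] c(1) by blast
    moreover from this b c(2) N have "b \<noteq> g" by fastforce
    ultimately show "\<exists>n. c = {n}"
      unfolding W_def by auto
  qed
  then show ?thesis ..
qed

section \<open>Existence of a splitting family whose members have infinite blocks\<close>

lemma partition_on_merge_blocks:
  assumes X: "partition_on UNIV X" and P: "P \<subseteq> X" "P \<noteq> {}"
  shows "partition_on UNIV (insert (\<Union>P) (X - P))" "insert (\<Union>P) (X - P) \<sqsubseteq> X"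
proof -
  have disj: "disjnt a b" if "a \<in> X" "b \<in> X" "a \<noteq> b" for a b
    using pairwiseD[OF partition_onD2[OF X]] that by blast
  show part: "partition_on UNIV (insert (\<Union>P) (X - P))"
  proof (rule partition_onI)
    show "\<Union>(insert (\<Union>P) (X - P)) = UNIV"
      unfolding partition_onD1[OF X] using P(1) by blast
    have "\<Union>P \<noteq> {}"
      using partition_onD3[OF X] P by (metis Union_empty_conv all_not_in_conv subsetD)
    then show "{} \<notin> insert (\<Union>P) (X - P)"
      using partition_onD3[OF X] by simp
    have "disjnt (\<Union>P) b" if "b \<in> X - P" for b
      unfolding disjnt_Union1 using disj that P(1) by blast
    then show "disjnt a b"
      if "a \<in> insert (\<Union>P) (X - P)" "b \<in> insert (\<Union>P) (X - P)" "a \<noteq> b" for a b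
      using that disj by (auto intro: disjnt_sym)
  qed
  show "insert (\<Union>P) (X - P) \<sqsubseteq> X"
    unfolding coarser_iff[OF part X] by blast
qed

text \<open>This makes the class defining \<open>splitting_number'\<close> nonempty. Cut
  \<open>X\<close> into two infinite halves \<open>P\<close> and \<open>Q\<close>: \<open>S\<close>
  fuses \<open>P\<close>, while \<open>Y\<close> fuses \<open>Q\<close> together with one block of
  \<open>P\<close>.\<close>

lemma ex_inf_block_splits:
  assumes X: "X \<in> inf_partitions"
  shows "\<exists>S\<in>inf_partitions_inf_block. splits S X"
proof -
  have part: "partition_on UNIV X" and inf: "infinite X"
    using X unfolding inf_partitions_def by auto
  note ne = partition_onD3[OF part]
  note un = partition_onD1[OF part]
  obtain e :: "nat \<Rightarrow> nat set" where e: "inj e" "range e \<subseteq> X"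
    using infinite_countable_subset[OF inf] by blast
  \<comment> \<open>Only even indices are used, so the odd ones keep the complement \<open>Q\<close>
    infinite.\<close>
  define P where "P = range (\<lambda>n. e (2 * n))"
  define Q where "Q = X - P"
  have infP: "infinite P"
    unfolding P_def by (intro range_inj_infinite) (auto intro!: injI dest: injD[OF e(1)])
  have "range (\<lambda>n. e (Suc (2 * n))) \<subseteq> Q"
    unfolding Q_def P_def using e by (auto simp: inj_eq) presburger
  moreover have "infinite (range (\<lambda>n. e (Suc (2 * n))))"
    by (intro range_inj_infinite) (auto intro!: injI dest: injD[OF e(1)])
  ultimately have infQ: "infinite Q"
    using finite_subset by blast
  have PX: "P \<subseteq> X" and XPQ: "X = P \<union> Q" and PQ: "P \<inter> Q = {}"
    using e(2) unfolding P_def Q_def by auto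
  obtain p where p: "p \<in> P" unfolding P_def by blast
  define S where "S = insert (\<Union>P) Q"
  \<comment> \<open>The block \<open>p\<close> links the two large blocks; fusing \<open>Q\<close>
    alone would leave \<open>\<Union>P\<close> and \<open>\<Union>Q\<close> as separate blocks of
    the common coarsening.\<close>
  define Y where "Y = insert (p \<union> \<Union>Q) (P - {p})"
  have pne: "p \<noteq> {}" using p PX ne by blast
  have "X - P = Q" using XPQ PQ by blast
  with partition_on_merge_blocks[OF part PX] p
  have S: "partition_on UNIV S" and SX: "S \<sqsubseteq> X"
    unfolding S_def by auto
  have "insert p Q \<subseteq> X" "\<Union>(insert p Q) = p \<union> \<Union>Q" "X - insert p Q = P - {p}"
    using XPQ PQ p by auto
  with partition_on_merge_blocks[OF part, of "insert p Q"]
  have Y: "partition_on UNIV Y" and YX: "Y \<sqsubseteq> X"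
    unfolding Y_def by auto
  have "infinite (\<Union>P)"
    using infP finite_UnionD by blast
  moreover have infS: "infinite S" using infQ by (simp add: S_def)
  ultimately have S_mem: "S \<in> inf_partitions_inf_block"
    using S unfolding inf_partitions_inf_block_def inf_partitions_def by (auto simp: S_def)
  have "S \<squnion> X = S"
    by (intro coarser_antisym common_coarsening[OF S part] S SX coarser_refl)
  then have "compatible S X"
    unfolding compatible_def inf_partitions_def using S infS by simp
  moreover have "Y \<in> inf_partitions"
    using Y infP unfolding inf_partitions_def Y_def by simp
  moreover have "S \<bottom> Y"
  proof -
    let ?Z = "S \<squnion> Y"
    note Z = common_coarsening[OF S Y]
    obtain a where a: "a \<in> ?Z" "\<Union>P \<subseteq> a"
      using Z(2) coarser_iff[OF Z(1) S] unfolding S_def by blast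
    obtain b where b: "b \<in> ?Z" "p \<union> \<Union>Q \<subseteq> b"
      using Z(3) coarser_iff[OF Z(1) Y] unfolding Y_def by blast
    \<comment> \<open>Both blocks contain the nonempty set \<open>p\<close>, so they coincide and
      cover \<open>\<Union>P\<close> and \<open>\<Union>Q\<close>.\<close>
    have "a = b"
      using a b p pne partition_onD2[OF Z(1)] unfolding disjoint_def by blast
    then have "a = UNIV"
      using a b un XPQ by blast
    have "c = UNIV" if "c \<in> ?Z" for c
    proof (rule ccontr)
      assume "c \<noteq> UNIV"
      with pairwiseD[OF partition_onD2[OF Z(1)] that a(1)] \<open>a = UNIV\<close> have "c = {}"
        by (simp add: disjnt_def)
      then show False using that partition_onD3[OF Z(1)] by simp
    qed
    with a(1) \<open>a = UNIV\<close> show ?thesis unfolding orthogonal_def by blast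
  qed
  ultimately have "splits S X"
    using YX unfolding splits_def by blast
  then show ?thesis using S_mem by blast
qed

section \<open>From splitting families to unbounded families\<close>

lemma finite_common_coarsening:
  assumes S: "partition_on UNIV S" and X: "partition_on UNIV X"
    and a: "a \<in> S" and N: "\<And>n. n \<ge> N \<Longrightarrow> \<exists>d\<in>X. n \<in> d \<and> d \<inter> a \<noteq> {}"
  shows "finite (S \<squnion> X)"
proof -
  note Z = common_coarsening[OF S X]
  note disj = partition_onD2[OF Z(1), unfolded disjoint_def]
  obtain c where c: "c \<in> S \<squnion> X" "a \<subseteq> c"
    using Z(2) coarser_iff[OF Z(1) S] a by blast
  \<comment> \<open>The block \<open>c\<close> around \<open>a\<close> absorbs every block of
    \<open>X\<close> that meets \<open>a\<close>.\<close>
  have large: "n \<in> c" if n: "n \<ge> N" for n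
  proof -
    obtain d where d: "d \<in> X" "n \<in> d" "d \<inter> a \<noteq> {}"
      using N[OF n] by blast
    then obtain b where b: "b \<in> S \<squnion> X" "d \<subseteq> b"
      using Z(3) coarser_iff[OF Z(1) X] by blast
    then have "b = c" using d c disj by blast
    then show ?thesis using b d by blast
  qed
  \<comment> \<open>Any other block is disjoint from \<open>c\<close>, so it lives below
    \<open>N\<close>, where there are only finitely many sets.\<close>
  have "S \<squnion> X \<subseteq> insert c (Pow {..<N})"
  proof
    fix b assume b: "b \<in> S \<squnion> X"
    show "b \<in> insert c (Pow {..<N})"
    proof (cases "b = c")
      case False
      then have "b \<inter> c = {}" using b c disj by blast
      then show ?thesis using large by (auto simp: not_less[symmetric])
    qed simp
  qed
  then show ?thesis by (rule finite_subset) simp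
qed

text \<open>By contraposition: a bound \<open>g\<close> yields one non-trivial interval partition
  that no member of the family splits, because compatibility already fails.\<close>

lemma unbounded_next_elements:
  assumes split: "splitting_family \<S>"
    and a: "\<And>S. S \<in> \<S> \<Longrightarrow> a S \<in> S \<and> infinite (a S)"
  shows "unbounded_family ((\<lambda>S n. LEAST m. m \<in> a S \<and> n \<le> m) ` \<S>)"
  unfolding unbounded_family_def
proof
  assume "\<exists>g. \<forall>f\<in>(\<lambda>S n. LEAST m. m \<in> a S \<and> n \<le> m) ` \<S>. eventually_dominated f g"
  then obtain g where g: "\<And>S. S \<in> \<S> \<Longrightarrow>
      eventually_dominated (\<lambda>n. LEAST m. m \<in> a S \<and> n \<le> m) g"
    by blast
  \<comment> \<open>The next endpoint exceeds \<open>g m\<close>, so any point between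
    \<open>m\<close> and \<open>g m\<close> falls into the interval starting at \<open>m\<close>.
    The summand 2 gives each interval at least two points even if \<open>g m = 0\<close>, which
    rules out triviality.\<close>
  define x where "x = rec_nat 0 (\<lambda>_ m. g m + m + 2)"
  have x_0: "x 0 = 0" and x_Suc: "x (Suc k) = g (x k) + x k + 2" for k
    by (simp_all add: x_def)
  have mono: "strict_mono x"
    by (simp add: strict_mono_Suc_iff x_Suc)
  have inc: "k \<le> x k" for k
    using mono by (rule strict_mono_imp_increasing)
  define I where "I k = {x k..<x (Suc k)}" for k
  have part: "partition_on UNIV (range I)"
    using partition_on_intervals[OF mono x_0] unfolding I_def .
  have "inj I"
  proof (rule injI)
    fix j k assume "I j = I k"
    then have "x j = x k"
      unfolding I_def using strict_monoD[OF mono lessI] atLeastLessThan_inj(1) by metis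
    then show "j = k" using mono by (simp add: strict_mono_eq)
  qed
  then have mem: "range I \<in> inf_partitions"
    using part range_inj_infinite unfolding inf_partitions_def by blast
  have "\<not> trivial_partition (range I)"
  proof
    assume "trivial_partition (range I)"
    from trivial_partition_eventually_singletons[OF part this]
    obtain N where N: "\<And>k. \<forall>m\<in>I k. m > N \<Longrightarrow> \<exists>n. I k = {n}"
      by (metis rangeI)
    \<comment> \<open>Index \<open>Suc N\<close> rather than \<open>N\<close>, since
      \<open>k \<le> x k\<close> must yield a strict inequality.\<close>
    have "\<forall>m\<in>I (Suc N). m > N"
      using inc[of "Suc N"] by (auto simp: I_def)
    then obtain n where "I (Suc N) = {n}" using N by blast
    moreover have "x (Suc N) \<in> I (Suc N)" "Suc (x (Suc N)) \<in> I (Suc N)"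
      unfolding I_def x_Suc[of "Suc N"] by auto
    ultimately show False by auto
  qed
  then obtain S where S: "S \<in> \<S>" "splits S (range I)"
    using split mem unfolding splitting_family_def by blast
  have S_part: "partition_on UNIV S"
    using split S(1) unfolding splitting_family_def inf_partitions_def by blast
  obtain K where K: "\<And>n. n \<ge> K \<Longrightarrow> (LEAST m. m \<in> a S \<and> n \<le> m) \<le> g n"
    using g[OF S(1)] unfolding eventually_dominated_def eventually_sequentially by blast
  have meets: "I k \<inter> a S \<noteq> {}" if "K \<le> k" for k
  proof -
    let ?m = "LEAST m. m \<in> a S \<and> x k \<le> m"
    \<comment> \<open>An infinite block is unbounded, so the \<open>LEAST\<close> is
      attained.\<close>
    have "\<exists>m. m \<in> a S \<and> x k \<le> m"
      using a[OF S(1)] by (meson infinite_nat_iff_unbounded_le)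
    then have "?m \<in> a S \<and> x k \<le> ?m" by (rule LeastI_ex)
    \<comment> \<open>The threshold \<open>K\<close> for arguments also serves for indices, as
      \<open>K \<le> k \<le> x k\<close>.\<close>
    moreover have "?m \<le> g (x k)"
      using K that inc[of k] by simp
    ultimately have "?m \<in> I k \<inter> a S" by (auto simp: I_def x_Suc)
    then show ?thesis by blast
  qed
  \<comment> \<open>Points from \<open>x K\<close> on lie in intervals of index at least
    \<open>K\<close>, all of which meet \<open>a S\<close>.\<close>
  have "\<exists>d\<in>range I. n \<in> d \<and> d \<inter> a S \<noteq> {}" if "x K \<le> n" for n
  proof -
    obtain k where k: "n \<in> I k"
      using partition_onD1[OF part] by blast
    then have "x K < x (Suc k)" using that by (simp add: I_def)
    then have "K \<le> k" using mono by (simp add: strict_mono_less)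
    then have "n \<in> I k \<and> I k \<inter> a S \<noteq> {}" using k meets by simp
    then show ?thesis by (rule rev_bexI[OF rangeI])
  qed
  then have "finite (S \<squnion> range I)"
    by (rule finite_common_coarsening[OF S_part part conjunct1[OF a[OF S(1)]]])
  then show False
    using S(2) unfolding splits_def compatible_def inf_partitions_def by blast
qed

theorem mainTheorem7:
  shows "bounding_number \<le>o splitting_number'"
proof -
  let ?\<A> = "{\<S>. splitting_family \<S> \<and> \<S> \<subseteq> inf_partitions_inf_block}"
  \<comment> \<open>\<open>least_card {}\<close> is unspecified, so some splitting family of the required kind must be exhibited.\<close>
  have "inf_partitions_inf_block \<in> ?\<A>"
    using ex_inf_block_splits
    unfolding splitting_family_def by (simp add: inf_partitions_inf_block_def)
  then have "?\<A> \<noteq> {}" by blast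
  from least_card(1)[OF this] obtain \<S> where split: "splitting_family \<S>"
    and sub: "\<S> \<subseteq> inf_partitions_inf_block" and card: "splitting_number' = |\<S>|"
    unfolding splitting_number'_def by blast
  have "\<forall>S\<in>\<S>. \<exists>b. b \<in> S \<and> infinite b"
    using sub unfolding inf_partitions_inf_block_def by blast
  then obtain a where "\<And>S. S \<in> \<S> \<Longrightarrow> a S \<in> S \<and> infinite (a S)"
    by metis
  then have "unbounded_family ((\<lambda>S n. LEAST m. m \<in> a S \<and> n \<le> m) ` \<S>)"
    by (rule unbounded_next_elements[OF split])
  then have "bounding_number \<le>o |(\<lambda>S n. LEAST m. m \<in> a S \<and> n \<le> m) ` \<S>|"
    unfolding bounding_number_def by (intro least_card(2)) blast+
  \<comment> \<open>Different partitions may give the same function, so the image is at most as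
    large as the family.\<close>
  also have "|(\<lambda>S n. LEAST m. m \<in> a S \<and> n \<le> m) ` \<S>| \<le>o splitting_number'"
    unfolding card by (rule card_of_image)
  finally show ?thesis .
qed

end
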